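(* Let $n = p_1^{k_1} p_2^{k_2} \cdots p_r^{k_r}$ be the prime factorization of a positive integer $n$, with distinct primes $p_i$ and integers $k_i \ge 1$, and let $D = \prod_{i=1}^r (k_i+1)$ be the number of divisors of $n$. Assume $n$ is not prime and $D \ge 3$. Then the Eccentric Connectivity index of the divisor prime graph $G_{Dp(n)}$ is $$\xi^c(G_{Dp(n)}) = 2\prod_{i=1}^r (2k_i+1) - D - 1.$$
   Context: For a positive integer $n$, the divisor prime graph $G_{Dp(n)}$ is the simple graph whose vertex set is the set of positive divisors of $n$, in which two distinct vertices $x, y$ are adjacent if and only if $\gcd(x,y) = 1$ (no loops). For a connected graph $G$ with degree function $d(\cdot)$ and shortest-path distance $d(u,v)$, the eccentricity of $v$ is $\varepsilon(v) = \max_{u \in V(G)} d(v,u)$, and the Eccentric Connectivity index is $\xi^c(G) = \sum_{v \in V(G)} d(v)\varepsilon(v)$. *)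

theory Defs
  imports
    "HOL-Computational_Algebra.Primes"
    "Graph_Theory.Pair_Digraph"
    "Graph_Theory.Digraph_Component"
    "Graph_Theory.Shortest_Path"
begin

text \<open>Undirected graphs are symmetric digraphs, as in \<^locale>\<open>graph\<close>: an edge is a pair of
  opposite arcs, so the degree of a vertex is its \<^const>\<open>out_degree\<close>.\<close>

definition divisor_prime_graph :: "nat \<Rightarrow> nat pair_pre_digraph" where
  "divisor_prime_graph n =
     \<lparr> pverts = {d. d dvd n},
       parcs = {(x, y). x dvd n \<and> y dvd n \<and> x \<noteq> y \<and> gcd x y = 1} \<rparr>"

text \<open>The distance and the eccentricity are unspecified when no walk exists, so they are only
  meaningful for (finite) connected graphs.\<close>

definition graph_dist :: "('a, 'b) pre_digraph \<Rightarrow> 'a \<Rightarrow> 'a \<Rightarrow> nat" where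
  "graph_dist G u v = (LEAST l. \<exists>w. pre_digraph.awalk G u w v \<and> length w = l)"

definition eccentricity :: "('a, 'b) pre_digraph \<Rightarrow> 'a \<Rightarrow> nat" where
  "eccentricity G v = Max ((\<lambda>u. graph_dist G v u) ` verts G)"

definition eccentric_connectivity_index :: "('a, 'b) pre_digraph \<Rightarrow> nat" where
  "eccentric_connectivity_index G = (\<Sum>v\<in>verts G. out_degree G v * eccentricity G v)"

lemma (in wf_digraph) graph_dist_eq_unit_weight_distance:
  assumes "u \<rightarrow>\<^sup>* v"
  shows "ereal (real (graph_dist G u v)) = \<mu> (\<lambda>_. 1) u v"
proof -
  have cost: "awalk_cost (\<lambda>_. 1) w = real (length w)" for w
    by (induction w) auto
  have "\<exists>l w. awalk u w v \<and> length w = l"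
    using assms by (auto simp: reachable_awalk)
  then have "\<exists>w. awalk u w v \<and> length w = graph_dist G u v"
    unfolding graph_dist_def by (rule LeastI_ex)
  then obtain w where w: "awalk u w v" "length w = graph_dist G u v"
    by blast
  have min: "graph_dist G u v \<le> length w'" if "awalk u w' v" for w'
    unfolding graph_dist_def using that by (auto intro: Least_le)
  show ?thesis
    unfolding \<mu>_def cost
    by (rule INF_eqI[symmetric]) (use w min in \<open>auto simp flip: w(2)\<close>)
qed

lemma pair_graph_divisor_prime_graph:
  assumes "n > 0"
  shows "pair_graph (divisor_prime_graph n)"
proof -
  have "finite {d. d dvd n}"
    using assms by simp
  moreover have "parcs (divisor_prime_graph n) \<subseteq> {d. d dvd n} \<times> {d. d dvd n}"
    by (auto simp: divisor_prime_graph_def)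
  ultimately have "finite (parcs (divisor_prime_graph n))"
    by (meson finite_SigmaI finite_subset)
  with assms show ?thesis
    by unfold_locales
      (auto simp: divisor_prime_graph_def symmetric_def sym_def gcd.commute)
qed

lemma connected_divisor_prime_graph:
  assumes "n > 0"
  shows "connected (with_proj (divisor_prime_graph n))"
proof -
  interpret pair_graph "divisor_prime_graph n"
    using assms by (rule pair_graph_divisor_prime_graph)
  have one: "1 \<in> pverts (divisor_prime_graph n)"
    by (simp add: divisor_prime_graph_def)
  have *: "x \<rightarrow>\<^sup>*\<^bsub>with_proj (divisor_prime_graph n)\<^esub> 1 \<and>
           1 \<rightarrow>\<^sup>*\<^bsub>with_proj (divisor_prime_graph n)\<^esub> x"
    if "x \<in> pverts (divisor_prime_graph n)" for x
  proof (cases "x = 1")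
    case True
    then show ?thesis using one by simp
  next
    case False
    then have "(x, 1) \<in> parcs (divisor_prime_graph n)" "(1, x) \<in> parcs (divisor_prime_graph n)"
      using that by (auto simp: divisor_prime_graph_def)
    then show ?thesis by simp
  qed
  show ?thesis
    using one * by (intro connectedI) (auto intro: reachable_mk_symmetricI reachable_trans)
qed

end

theory Submission
  imports Defs
begin

text \<open>The vertex \<open>1\<close> is adjacent to all others, so it has eccentricity \<open>1\<close>, while every other
  vertex has eccentricity \<open>2\<close>. Hence the index is twice the degree sum minus the degree \<open>D - 1\<close> of
  \<open>1\<close>. The degree sum counts the ordered pairs of coprime divisors of \<open>n\<close> other than \<open>(1, 1)\<close>; the
  number of coprime pairs is multiplicative in \<open>n\<close>, with value \<open>2k + 1\<close> at a prime power \<open>p\<^sup>k\<close>.\<close>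

section \<open>Divisors and coprime pairs of divisors of a product\<close>

lemma bij_betw_mult_divisors:
  fixes a b :: nat
  assumes "coprime a b"
  shows "bij_betw (\<lambda>(x, y). x * y) ({d. d dvd a} \<times> {d. d dvd b}) {d. d dvd a * b}"
  unfolding bij_betw_def
proof
  have "coprime x y" if "x dvd a" "y dvd b" for x y
    using coprime_divisors[OF that assms] .
  then show "inj_on (\<lambda>(x, y). x * y) ({d. d dvd a} \<times> {d. d dvd b})"
    using mult_inj_if_coprime_nat[of "\<lambda>x. x" "{d. d dvd a}" "\<lambda>x. x" "{d. d dvd b}"]
    by simp
  show "(\<lambda>(x, y). x * y) ` ({d. d dvd a} \<times> {d. d dvd b}) = {d. d dvd a * b}"
  proof (intro equalityI subsetI)
    fix d assume "d \<in> {d. d dvd a * b}"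
    then obtain x y where "d = x * y" "x dvd a" "y dvd b"
      using division_decomp[of d a b] by auto
    then show "d \<in> (\<lambda>(x, y). x * y) ` ({d. d dvd a} \<times> {d. d dvd b})"
      by (intro image_eqI[of _ _ "(x, y)"]) simp_all
  qed (auto intro: mult_dvd_mono)
qed

text \<open>This is the multiplicativity of the number of coprime pairs. A divisor of
  \<open>a\<close> is always coprime to a divisor of \<open>b\<close>, so \<open>u * x\<close> and
  \<open>v * y\<close> are coprime exactly when \<open>u\<close>, \<open>v\<close> are and
  \<open>x\<close>, \<open>y\<close> are.\<close>

lemma bij_betw_mult_coprime_divisors:
  fixes a b :: nat
  assumes "coprime a b"
  shows "bij_betw (\<lambda>((u, v), (x, y)). (u * x, v * y))
     ({(u, v). u dvd a \<and> v dvd a \<and> coprime u v} \<times> {(x, y). x dvd b \<and> y dvd b \<and> coprime x y})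
     {(x, y). x dvd a * b \<and> y dvd a * b \<and> coprime x y}"
proof -
  let ?C = "\<lambda>n. {(x, y). x dvd n \<and> y dvd n \<and> coprime x y}"
  let ?f = "\<lambda>((u, v), (x, y)). (u * x, v * y)"
  have cop: "coprime u y" "coprime y u" if "u dvd a" "y dvd b" for u y
    using coprime_divisors[OF that assms] by (simp_all add: coprime_commute)
  show ?thesis unfolding bij_betw_def
  proof (intro conjI equalityI subsetI)
    \<comment> \<open>Each coordinate is recovered separately: with the factors crosswise coprime,
      \<open>coprime_crossproduct_nat\<close> turns an equality of products into equalities of
      factors.\<close>
    show "inj_on ?f (?C a \<times> ?C b)"
      by (rule inj_onI) (clarsimp simp: cop coprime_crossproduct_nat)
  next
    fix z assume "z \<in> ?f ` (?C a \<times> ?C b)"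
    then show "z \<in> ?C (a * b)"
      by (clarsimp simp: cop mult_dvd_mono)
  next
    fix z assume "z \<in> ?C (a * b)"
    then obtain s t where z: "z = (s, t)" "s dvd a * b" "t dvd a * b" "coprime s t"
      by auto
    from z(2) obtain u x where s: "s = u * x" "u dvd a" "x dvd b"
      using division_decomp[of s a b] by auto
    from z(3) obtain v y where t: "t = v * y" "v dvd a" "y dvd b"
      using division_decomp[of t a b] by auto
    have "((u, v), (x, y)) \<in> ?C a \<times> ?C b" "z = ?f ((u, v), (x, y))"
      using z s t by simp_all
    then show "z \<in> ?f ` (?C a \<times> ?C b)" by (rule rev_image_eqI)
  qed
qed

lemma card_divisors_prime_power:
  fixes p :: nat
  assumes "prime p"
  shows "card {d. d dvd p ^ k} = k + 1"
proof -
  have "{d. d dvd p ^ k} = (\<lambda>i. p ^ i) ` {..k}"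
    using divides_primepow_nat[OF assms] by auto
  moreover have "inj_on (\<lambda>i. p ^ i) {..k}"
    using prime_gt_1_nat[OF assms] by (auto simp: inj_on_def)
  ultimately show ?thesis by (simp add: card_image)
qed

text \<open>Two positive powers of \<open>p\<close> share the factor \<open>p\<close>, so one entry
  of a coprime pair must be 1.\<close>

lemma card_coprime_divisors_prime_power:
  fixes p :: nat
  assumes "prime p"
  shows "card {(x, y). x dvd p ^ k \<and> y dvd p ^ k \<and> coprime x y} = 2 * k + 1"
proof -
  have p: "p > 1" using prime_gt_1_nat[OF assms] .
  \<comment> \<open>The second family starts at exponent 1, so that \<open>(1, 1)\<close> is counted
    only in the first and the union is disjoint.\<close>
  have "{(x, y). x dvd p ^ k \<and> y dvd p ^ k \<and> coprime x y} =
      (\<lambda>i. (p ^ i, 1)) ` {..k} \<union> (\<lambda>i. (1, p ^ i)) ` {1..k}" (is "?L = ?A \<union> ?B")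
  proof (intro equalityI subsetI)
    fix z assume "z \<in> ?L"
    then obtain i j where "z = (p ^ i, p ^ j)" "i \<le> k" "j \<le> k" "coprime (p ^ i) (p ^ j)"
      using divides_primepow_nat[OF assms] by auto
    moreover from this p have "i = 0 \<or> j = 0" by (auto simp: coprime_power_left_iff)
    ultimately show "z \<in> ?A \<union> ?B" by (cases "j = 0") auto
  qed (auto simp: le_imp_power_dvd)
  moreover have "?A \<inter> ?B = {}" using p by (auto simp: eq_commute[of "Suc 0"])
  moreover have "card ?A = k + 1" "card ?B = k"
    using p by (simp_all add: card_image inj_on_def)
  ultimately show ?thesis by (simp add: card_Un_disjoint)
qed

text \<open>Supplies the coprimality needed to split off one prime power in the two inductions
  below.\<close>

lemma coprime_prod_prime_powers:
  fixes p :: "'a \<Rightarrow> nat"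
  assumes "i \<notin> I" "\<And>j. j \<in> insert i I \<Longrightarrow> prime (p j)" "inj_on p (insert i I)"
  shows "coprime (p i ^ k i) (\<Prod>j\<in>I. p j ^ k j)"
proof (rule prod_coprime_right)
  fix j assume "j \<in> I"
  with assms have "p i \<noteq> p j" by (auto simp: inj_on_def)
  with assms \<open>j \<in> I\<close> show "coprime (p i ^ k i) (p j ^ k j)"
    by (auto intro!: coprime_power_left_iff[THEN iffD2] primes_coprime)
qed

lemma card_divisors_prod_prime_powers:
  fixes p :: "'a \<Rightarrow> nat"
  assumes "finite I" "\<And>i. i \<in> I \<Longrightarrow> prime (p i)" "inj_on p I"
  shows "card {d. d dvd (\<Prod>i\<in>I. p i ^ k i)} = (\<Prod>i\<in>I. k i + 1)"
  using assms
proof (induction I rule: finite_induct)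
  case (insert i I)
  have "coprime (p i ^ k i) (\<Prod>j\<in>I. p j ^ k j)"
    using insert(2,4,5) by (rule coprime_prod_prime_powers)
  from bij_betw_same_card[OF bij_betw_mult_divisors[OF this]] show ?case using insert
    by (simp add: card_cartesian_product card_divisors_prime_power)
qed simp

lemma card_coprime_divisors_prod_prime_powers:
  fixes p :: "'a \<Rightarrow> nat"
  assumes "finite I" "\<And>i. i \<in> I \<Longrightarrow> prime (p i)" "inj_on p I"
  shows "card {(x, y). x dvd (\<Prod>i\<in>I. p i ^ k i) \<and> y dvd (\<Prod>i\<in>I. p i ^ k i) \<and> coprime x y} =
    (\<Prod>i\<in>I. 2 * k i + 1)"
  using assms
proof (induction I rule: finite_induct)
  case empty
  have "{(x, y). x = 1 \<and> y = (1::nat)} = {(1, 1)}" by auto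
  then show ?case by (simp cong: conj_cong)
next
  case (insert i I)
  have "coprime (p i ^ k i) (\<Prod>j\<in>I. p j ^ k j)"
    using insert(2,4,5) by (rule coprime_prod_prime_powers)
  from bij_betw_same_card[OF bij_betw_mult_coprime_divisors[OF this]] show ?case using insert
    by (simp add: card_cartesian_product card_coprime_divisors_prime_power)
qed

section \<open>Distances and eccentricities\<close>

lemma (in wf_digraph) graph_dist_self:
  assumes "v \<in> verts G"
  shows "graph_dist G v v = 0"
  unfolding graph_dist_def
  using assms by (intro Least_eq_0) (auto simp: awalk_Nil_iff)

lemma (in wf_digraph) graph_dist_le:
  assumes "awalk u w v"
  shows "graph_dist G u v \<le> length w"
  unfolding graph_dist_def using assms by (auto intro: Least_le)

text \<open>Once some walk exists, the minimum is attained. Lower bounds on the distance then follow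
  by ruling out short walks.\<close>

lemma (in wf_digraph) awalk_graph_dist:
  assumes "awalk u w v"
  obtains w' where "awalk u w' v" "length w' = graph_dist G u v"
proof -
  have "\<exists>l w. awalk u w v \<and> length w = l"
    using assms by blast
  then have "\<exists>w. awalk u w v \<and> length w = graph_dist G u v"
    unfolding graph_dist_def by (rule LeastI_ex)
  then show ?thesis using that by blast
qed

text \<open>Distinct vertices that are not coprime are both different from 1, and 1 is a common
  neighbour of them.\<close>

lemma graph_dist_divisor_prime_graph:
  assumes "n > 0" "x dvd n" "y dvd n"
  shows "graph_dist (with_proj (divisor_prime_graph n)) x y =
    (if x = y then 0 else if coprime x y then 1 else 2)"
proof -
  let ?G = "with_proj (divisor_prime_graph n)"
  interpret pair_graph "divisor_prime_graph n"
    using assms(1) by (rule pair_graph_divisor_prime_graph)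
  have arc: "(a, b) \<in> parcs (divisor_prime_graph n) \<longleftrightarrow>
      a dvd n \<and> b dvd n \<and> a \<noteq> b \<and> coprime a b" for a b
    by (auto simp: divisor_prime_graph_def coprime_iff_gcd_eq_1)
  have vert: "a \<in> pverts (divisor_prime_graph n) \<longleftrightarrow> a dvd n" for a
    by (simp add: divisor_prime_graph_def)
  consider "x = y" | "x \<noteq> y" "coprime x y" | "x \<noteq> y" "\<not> coprime x y" by blast
  then show ?thesis
  proof cases
    case 1
    then show ?thesis using assms graph_dist_self vert by simp
  next
    case 2
    then have w: "awalk x [(x, y)] y"
      using assms by (simp add: awalk_Cons_iff awalk_Nil_iff arc vert)
    obtain w' where w': "awalk x w' y" "length w' = graph_dist ?G x y"
      using awalk_graph_dist[OF w] .
    from w'(1) 2 have "w' \<noteq> []" by (auto simp: awalk_Nil_iff)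
    with w'(2) graph_dist_le[OF w] 2 show ?thesis by (cases w') auto
  next
    case 3
    then have "x \<noteq> 1" "y \<noteq> 1" by auto
    then have w: "awalk x [(x, 1), (1, y)] y"
      using assms by (simp add: awalk_Cons_iff awalk_Nil_iff arc vert)
    obtain w' where w': "awalk x w' y" "length w' = graph_dist ?G x y"
      using awalk_graph_dist[OF w] .
    from w'(1) 3 have "w' \<noteq> []" by (auto simp: awalk_Nil_iff)
    \<comment> \<open>A walk with a single arc would make \<open>x\<close> and \<open>y\<close>
      adjacent, hence coprime.\<close>
    moreover from w'(1) 3 have "w' \<noteq> [e]" for e
      by (cases e) (auto simp: awalk_Cons_iff awalk_Nil_iff arc)
    \<comment> \<open>\<open>remdups_adj.cases\<close> serves only to split lists into empty,
      singleton and longer ones.\<close>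
    ultimately have "length w' \<ge> 2" by (cases w' rule: remdups_adj.cases) auto
    with w'(2) graph_dist_le[OF w] 3 show ?thesis by auto
  qed
qed

text \<open>The bound on the number of divisors excludes prime \<open>n\<close>, where the vertex
  \<open>n\<close> would have eccentricity 1.\<close>

lemma eccentricity_divisor_prime_graph:
  assumes "n > 0" "card {d. d dvd n} \<ge> 3" "v dvd n"
  shows "eccentricity (with_proj (divisor_prime_graph n)) v = (if v = 1 then 1 else 2)"
proof -
  let ?dist = "graph_dist (with_proj (divisor_prime_graph n)) v"
  have dist: "?dist u = (if v = u then 0 else if coprime v u then 1 else 2)" if "u dvd n" for u
    using graph_dist_divisor_prime_graph[OF assms(1,3) that] .
  have fin: "finite (?dist ` {d. d dvd n})" using assms(1) by simp
  \<comment> \<open>Such a proper divisor is what puts a vertex at distance 2 from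
    \<open>n\<close>.\<close>
  have "\<exists>u. u dvd n \<and> u \<notin> {1, n}"
  proof (rule ccontr)
    assume "\<not> ?thesis"
    then have "card {d. d dvd n} \<le> card {1, n}" by (intro card_mono) auto
    also have "\<dots> \<le> 2" by (simp add: card_insert_if)
    finally show False using assms(2) by simp
  qed
  then obtain u where u: "u dvd n" "u \<noteq> 1" "u \<noteq> n" by auto
  have "Max (?dist ` {d. d dvd n}) = (if v = 1 then 1 else 2)"
  proof (rule Max_eqI[OF fin])
    show "y \<le> (if v = 1 then 1 else 2)" if "y \<in> ?dist ` {d. d dvd n}" for y
      using that dist by auto
    show "(if v = 1 then 1 else 2) \<in> ?dist ` {d. d dvd n}"
    proof (cases "v = 1")
      case True
      then have "?dist u = 1" using dist u by auto
      then show ?thesis using True u by force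
    next
      case False
      \<comment> \<open>\<open>v\<close> shares a factor with \<open>n\<close>, and \<open>n\<close> itself shares one with \<open>u\<close>.\<close>
      define w where "w = (if v = n then u else n)"
      have "w dvd n" "?dist w = 2"
        using u False assms(3) by (auto simp: w_def dist coprime_commute
           dest: coprime_common_divisor_nat coprime_absorb_left coprime_absorb_right)
      then show ?thesis using False by force
    qed
  qed
  then show ?thesis by (simp add: eccentricity_def divisor_prime_graph_def)
qed

section \<open>Degree sums and the index\<close>

lemma sum_out_degree:
  assumes "fin_digraph G"
  shows "(\<Sum>v\<in>verts G. out_degree G v) = card (arcs G)"
proof -
  interpret fin_digraph G by fact
  have "(\<Union>v\<in>verts G. out_arcs G v) = arcs G" by auto
  moreover have "card (\<Union>v\<in>verts G. out_arcs G v) = (\<Sum>v\<in>verts G. card (out_arcs G v))"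
    by (rule card_UN_disjoint) auto
  ultimately show ?thesis by (simp add: out_degree_def)
qed

text \<open>The extra 1 is the pair \<open>(1, 1)\<close>, the only coprime pair with equal entries,
  which is not an arc because there are no loops.\<close>

lemma card_arcs_divisor_prime_graph:
  assumes "n > 0"
  shows "card (parcs (divisor_prime_graph n)) + 1 =
    card {(x, y). x dvd n \<and> y dvd n \<and> coprime x y}"
proof -
  interpret pair_graph "divisor_prime_graph n"
    using assms by (rule pair_graph_divisor_prime_graph)
  have "{(x, y). x dvd n \<and> y dvd n \<and> coprime x y} = insert (1, 1) (parcs (divisor_prime_graph n))"
    by (auto simp: divisor_prime_graph_def coprime_iff_gcd_eq_1)
  moreover have "(1, 1) \<notin> parcs (divisor_prime_graph n)"
    by (simp add: divisor_prime_graph_def)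
  ultimately show ?thesis by simp
qed

lemma out_degree_one_divisor_prime_graph:
  assumes "n > 0"
  shows "out_degree (with_proj (divisor_prime_graph n)) 1 + 1 = card {d. d dvd n}"
proof -
  have "out_arcs (with_proj (divisor_prime_graph n)) 1 = Pair 1 ` ({d. d dvd n} - {1})"
    by (auto simp: divisor_prime_graph_def out_arcs_def)
  then have "out_degree (with_proj (divisor_prime_graph n)) 1 = card ({d. d dvd n} - {1})"
    by (simp add: out_degree_def card_image inj_on_def)
  moreover have "card {d. d dvd n} > 0" using assms by (auto simp: card_gt_0_iff)
  ultimately show ?thesis using assms by simp
qed

text \<open>The additive form avoids truncated subtraction on \<open>nat\<close>.\<close>

lemma eccentric_connectivity_index_divisor_prime_graph:
  assumes "n > 0" "card {d. d dvd n} \<ge> 3"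
  shows "eccentric_connectivity_index (with_proj (divisor_prime_graph n)) + card {d. d dvd n} + 1 =
    2 * card {(x, y). x dvd n \<and> y dvd n \<and> coprime x y}"
proof -
  let ?G = "with_proj (divisor_prime_graph n)"
  interpret pair_graph "divisor_prime_graph n"
    using assms(1) by (rule pair_graph_divisor_prime_graph)
  have verts: "pverts (divisor_prime_graph n) = {d. d dvd n}" by (simp add: divisor_prime_graph_def)
  \<comment> \<open>Adding the degree of 1 once more, written as a sum over all vertices, raises its
    weight from 1 to 2, so every degree is then weighted by 2.\<close>
  have "eccentric_connectivity_index ?G + out_degree ?G 1 =
      (\<Sum>v | v dvd n. out_degree ?G v * (if v = 1 then 1 else 2)) +
      (\<Sum>v | v dvd n. if v = 1 then out_degree ?G v else 0)"
    using assms by (simp add: eccentric_connectivity_index_def verts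
       eccentricity_divisor_prime_graph)
  also have "\<dots> = 2 * (\<Sum>v\<in>verts ?G. out_degree ?G v)"
    by (simp only: sum.distrib[symmetric] sum_distrib_left verts with_proj_simps) (rule sum.cong, auto)
  also have "\<dots> = 2 * card (parcs (divisor_prime_graph n))"
    by (subst sum_out_degree) (simp_all add: fin_digraph_axioms)
  \<comment> \<open>With \<open>D\<close> divisors and \<open>C\<close> coprime pairs, the index
    plus \<open>D - 1\<close> equals \<open>2 * (C - 1)\<close>.\<close>
  finally show ?thesis
    using card_arcs_divisor_prime_graph[OF assms(1)]
      out_degree_one_divisor_prime_graph[OF assms(1)] by linarith
qed

theorem theorem3p7:
  fixes n r D :: nat and p k :: "nat \<Rightarrow> nat"
  assumes "\<And>i. i \<in> {1..r} \<Longrightarrow> prime (p i)"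
    and "inj_on p {1..r}"
    and "\<And>i. i \<in> {1..r} \<Longrightarrow> k i \<ge> 1"
    and "n = (\<Prod>i = 1..r. p i ^ k i)"
    and "D = (\<Prod>i = 1..r. (k i + 1))"
    and "\<not> prime n"
    and "D \<ge> 3"
  shows "int (eccentric_connectivity_index (with_proj (divisor_prime_graph n))) =
           2 * (\<Prod>i = 1..r. (2 * int (k i) + 1)) - int D - 1"
proof -
  have "n > 0"
    using assms(1) unfolding assms(4) by (intro prod_pos) (simp add: prime_gt_0_nat)
  have D: "card {d. d dvd n} = D"
    unfolding assms(4,5) by (rule card_divisors_prod_prime_powers) (use assms in auto)
  have C: "card {(x, y). x dvd n \<and> y dvd n \<and> coprime x y} = (\<Prod>i = 1..r. 2 * k i + 1)"
    unfolding assms(4) by (rule card_coprime_divisors_prod_prime_powers) (use assms in auto)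
  have "eccentric_connectivity_index (with_proj (divisor_prime_graph n)) + D + 1 =
      2 * (\<Prod>i = 1..r. 2 * k i + 1)"
    using eccentric_connectivity_index_divisor_prime_graph[OF \<open>n > 0\<close>] \<open>D \<ge> 3\<close>
    unfolding D C by simp
  \<comment> \<open>The additive identity is transferred to \<open>int\<close> first, and only there
    are \<open>D\<close> and 1 moved to the other side.\<close>
  then have "int (eccentric_connectivity_index (with_proj (divisor_prime_graph n)) + D + 1) =
      int (2 * (\<Prod>i = 1..r. 2 * k i + 1))"
    by (rule arg_cong)
  also have "\<dots> = 2 * (\<Prod>i = 1..r. 2 * int (k i) + 1)"
    by (simp add: add.commute)
  finally show ?thesis by simp
qed

end
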